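(* Consider the system $x(t+1)=f(x(t),u(t))$, $x(0)=x_0$, the constraint set $\mathbb{Z}\subseteq\mathbb{X}\times\mathbb{U}$, the stage cost $\ell$, the control law $\kappa$ and the finite-tail cost MPC problem $\mathcal{P}_{N,M}$ with value function $V_{N,M}$, all as described in the context. Suppose that: (A1) there exist functions $\underline{\alpha}_\ell,\overline{\alpha}_\ell\in\mathcal{K}_\infty$ such that $\underline{\alpha}_\ell(\|x\|)\leq \ell_{\min}(x)\leq \overline{\alpha}_\ell(\|x\|)$ for all $x\in\mathbb{X}$, and $\ell(0,0)=0$; (A2) there exist constants $\rho\in[0,1)$, $C\geq 1$, $\epsilon>0$ such that for all $x\in\mathbb{X}$ with $\ell_{\min}(x)\leq\epsilon$ and all $k\in\mathbb{I}_{\geq 0}$, $$\ell_\kappa(\phi_{\mathrm{x}}(k,x))\leq C\rho^{k}\ell_{\min}(x),\qquad (\phi_{\mathrm{x}}(k,x),\phi_{\mathrm{u}}(k,x))\in\mathbb{Z}.$$ Then for any $\overline{V}>0$ and any $M\in\mathbb{I}_{\geq 1}$ there exists a constant $N_{\overline{V},M}\geq 0$ such that for all $N\in\mathbb{I}_{\geq 1}$ with $N>N_{\overline{V},M}$ and any initial condition $x_0\in\mathbb{X}_{\overline{V}}:=\{x\in\mathbb{X}\mid V_{N,M}(x)\leq\overline{V}\}$, the problem $\mathcal{P}_{N,M}(x(t))$ is feasible for all $t\in\mathbb{I}_{\geq 0}$ along the closed loop, the constraints $(x(t),u(t))\in\mathbb{Z}$ are satisfied for all $t\in\mathbb{I}_{\geq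 0}$, and the origin is asymptotically stable for the resulting closed loop. Furthermore, there exist constants $\alpha_{N,M}\in(0,1]$ and $\epsilon_{N,M}\in(0,1]$ (independent of $x_0\in\mathbb{X}_{\overline{V}}$) such that the resulting closed loop satisfies $$\sum_{k=0}^\infty \ell(x(k),u(k))\leq\frac{1}{\epsilon_{N,M}}V_{N,M}(x_0)\leq\frac{1}{\alpha_{N,M}}V_{\infty,0}(x_0).$$
   Context: Notation: $\mathbb{I}_{\geq a}$ denotes the integers $\geq a$, $\mathbb{I}_{[a,b]}$ the integers in $[a,b]$. $\mathcal{K}_\infty$ is the set of continuous, strictly increasing, unbounded functions $\alpha:\mathbb{R}_{\geq0}\to\mathbb{R}_{\geq0}$ with $\alpha(0)=0$. Convention: $0^0=1$. Setup: $\mathbb{X}=\mathbb{R}^n$, $\mathbb{U}\subseteq\mathbb{R}^m$ is compact, $f:\mathbb{X}\times\mathbb{U}\to\mathbb{X}$ and $\ell:\mathbb{X}\times\mathbb{U}\to\mathbb{R}_{\geq0}$ are continuous, $f(0,0)=0$, $\mathbb{Z}\subseteq\mathbb{X}\times\mathbb{U}$ with $0\in\mathrm{int}(\mathbb{Z})$. Define $\ell_{\min}(x):=\inf_{u\in\mathbb{U}}\ell(x,u)$. The control law $\kappa:\mathbb{X}\to\mathbb{U}$ is a given continuous function and $\ell_\kappa(x):=\ell(x,\kappa(x))$. The response under $\kappa$ is defined by $\phi_{\mathrm{x}}(0,x):=x$, $\phi_{\mathrm{u}}(k,x):=\kappa(\phi_{\mathrm{x}}(k,x))$, $\phi_{\mathrm{x}}(k+1,x):=f(\phi_{\mathrm{x}}(k,x),\phi_{\mathrm{u}}(k,x))$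 for $k\in\mathbb{I}_{\geq0}$. Finite-tail cost: for $M\in\mathbb{I}_{\geq1}$, $V_{\mathrm{f},M}(x):=\sum_{k=0}^{M-1}\ell_\kappa(\phi_{\mathrm{x}}(k,x))$ if $(\phi_{\mathrm{x}}(k,x),\phi_{\mathrm{u}}(k,x))\in\mathbb{Z}$ for all $k\in\mathbb{I}_{[0,M-1]}$, and $V_{\mathrm{f},M}(x):=\infty$ otherwise. MPC problem $\mathcal{P}_{N,M}(x)$, with prediction horizon $N\in\mathbb{I}_{\geq1}$ and extended horizon $M\in\mathbb{I}_{\geq1}$: minimize $$\sum_{k=0}^{N-1}\ell(x(k),u(k))+V_{\mathrm{f},M}(x(N))$$ over input sequences $u(0),\dots,u(N-1)\in\mathbb{U}$, subject to $x(0)=x$, $x(k+1)=f(x(k),u(k))$ and $(x(k),u(k))\in\mathbb{Z}$ for $k\in\mathbb{I}_{[0,N-1]}$. The problem is feasible if some input sequence satisfies the constraints with finite cost. $V_{N,M}(x)$ denotes the optimal value, with $V_{N,M}(x)=\infty$ if the problem is not feasible. Whenever the problem is feasible, a minimizer is taken to exist. Infinite-horizon optimal cost: $V_{\infty,0}(x)$ is the infimum of $\sum_{k=0}^\infty\ell(x(k),u(k))$ over all infinite sequences with $x(0)=x$, $x(k+1)=f(x(k),u(k))$, $(x(k),u(k))\in\mathbb{Z}$ for all $k\in\mathbb{I}_{\geq0}$ ($=\infty$ if there are none). Closed loop: at each time $t\in\mathbb{I}_{\geq0}$, $u(t)$ is the first element of a minimizing input sequence of $\mathcal{P}_{N,M}(x(t))$,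 and $x(t+1)=f(x(t),u(t))$, $x(0)=x_0$. Asymptotic stability of the origin (for initial conditions in $\mathbb{X}_{\overline{V}}$): for every $\eta>0$ there is $\delta>0$ such that every closed-loop trajectory with $x_0\in\mathbb{X}_{\overline{V}}$ and $\|x_0\|\leq\delta$ satisfies $\|x(t)\|\leq\eta$ for all $t\in\mathbb{I}_{\geq 0}$, and every closed-loop trajectory with $x_0\in\mathbb{X}_{\overline{V}}$ satisfies $x(t)\to0$ as $t\to\infty$. *)

theory Defs
  imports "HOL-Analysis.Analysis"
begin

definition class_K_inf :: "(real \<Rightarrow> real) \<Rightarrow> bool" where
  "class_K_inf \<alpha> \<longleftrightarrow>
     \<alpha> \<in> {0..} \<rightarrow> {0..} \<and> continuous_on {0..} \<alpha> \<and> strict_mono_on {0..} \<alpha> \<and>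
     \<not> bdd_above (\<alpha> ` {0..}) \<and> \<alpha> 0 = 0"

definition stage_min :: "'u set \<Rightarrow> ('x \<Rightarrow> 'u \<Rightarrow> real) \<Rightarrow> 'x \<Rightarrow> real" where
  "stage_min U l x = (INF u\<in>U. l x u)"

definition stage_fb :: "('x \<Rightarrow> 'u \<Rightarrow> real) \<Rightarrow> ('x \<Rightarrow> 'u) \<Rightarrow> 'x \<Rightarrow> real" where
  "stage_fb l \<kappa> x = l x (\<kappa> x)"

primrec phi_x :: "('x \<Rightarrow> 'u \<Rightarrow> 'x) \<Rightarrow> ('x \<Rightarrow> 'u) \<Rightarrow> nat \<Rightarrow> 'x \<Rightarrow> 'x" where
  "phi_x f \<kappa> 0 x = x"
| "phi_x f \<kappa> (Suc k) x = f (phi_x f \<kappa> k x) (\<kappa> (phi_x f \<kappa> k x))"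

definition phi_u :: "('x \<Rightarrow> 'u \<Rightarrow> 'x) \<Rightarrow> ('x \<Rightarrow> 'u) \<Rightarrow> nat \<Rightarrow> 'x \<Rightarrow> 'u" where
  "phi_u f \<kappa> k x = \<kappa> (phi_x f \<kappa> k x)"

text \<open>
  Costs take values in \<^typ>\<open>ennreal\<close>. The coercion \<^const>\<open>ennreal\<close> truncates negative reals,
  but stage costs are nonnegative for inputs in \<open>U\<close>, so it is the plain embedding wherever
  it matters. The infimum of the empty set is \<open>\<infinity>\<close>.
\<close>

definition tail_cost ::
  "('x \<Rightarrow> 'u \<Rightarrow> 'x) \<Rightarrow> ('x \<times> 'u) set \<Rightarrow> ('x \<Rightarrow> 'u \<Rightarrow> real) \<Rightarrow> ('x \<Rightarrow> 'u) \<Rightarrow>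
   nat \<Rightarrow> 'x \<Rightarrow> ennreal" where
  "tail_cost f Z l \<kappa> M x =
     (if \<forall>k<M. (phi_x f \<kappa> k x, phi_u f \<kappa> k x) \<in> Z
      then (\<Sum>k<M. ennreal (stage_fb l \<kappa> (phi_x f \<kappa> k x)))
      else \<infinity>)"

primrec open_loop :: "('x \<Rightarrow> 'u \<Rightarrow> 'x) \<Rightarrow> 'x \<Rightarrow> (nat \<Rightarrow> 'u) \<Rightarrow> nat \<Rightarrow> 'x" where
  "open_loop f x u 0 = x"
| "open_loop f x u (Suc k) = f (open_loop f x u k) (u k)"

text \<open>
  An input sequence of length \<open>N\<close> is a function on \<^typ>\<open>nat\<close> of which only the values below
  \<open>N\<close> matter.
\<close>

definition admissible ::
  "('x \<Rightarrow> 'u \<Rightarrow> 'x) \<Rightarrow> 'u set \<Rightarrow> ('x \<times> 'u) set \<Rightarrow> nat \<Rightarrow> 'x \<Rightarrow> (nat \<Rightarrow> 'u) set" where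
  "admissible f U Z N x = {u. \<forall>k<N. u k \<in> U \<and> (open_loop f x u k, u k) \<in> Z}"

definition mpc_cost ::
  "('x \<Rightarrow> 'u \<Rightarrow> 'x) \<Rightarrow> ('x \<times> 'u) set \<Rightarrow> ('x \<Rightarrow> 'u \<Rightarrow> real) \<Rightarrow> ('x \<Rightarrow> 'u) \<Rightarrow>
   nat \<Rightarrow> nat \<Rightarrow> 'x \<Rightarrow> (nat \<Rightarrow> 'u) \<Rightarrow> ennreal" where
  "mpc_cost f Z l \<kappa> N M x u =
     (\<Sum>k<N. ennreal (l (open_loop f x u k) (u k))) + tail_cost f Z l \<kappa> M (open_loop f x u N)"

definition mpc_feasible ::
  "('x \<Rightarrow> 'u \<Rightarrow> 'x) \<Rightarrow> 'u set \<Rightarrow> ('x \<times> 'u) set \<Rightarrow> ('x \<Rightarrow> 'u \<Rightarrow> real) \<Rightarrow> ('x \<Rightarrow> 'u) \<Rightarrow>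
   nat \<Rightarrow> nat \<Rightarrow> 'x \<Rightarrow> bool" where
  "mpc_feasible f U Z l \<kappa> N M x \<longleftrightarrow>
     (\<exists>u \<in> admissible f U Z N x. mpc_cost f Z l \<kappa> N M x u < \<infinity>)"

definition mpc_value ::
  "('x \<Rightarrow> 'u \<Rightarrow> 'x) \<Rightarrow> 'u set \<Rightarrow> ('x \<times> 'u) set \<Rightarrow> ('x \<Rightarrow> 'u \<Rightarrow> real) \<Rightarrow> ('x \<Rightarrow> 'u) \<Rightarrow>
   nat \<Rightarrow> nat \<Rightarrow> 'x \<Rightarrow> ennreal" where
  "mpc_value f U Z l \<kappa> N M x = (INF u \<in> admissible f U Z N x. mpc_cost f Z l \<kappa> N M x u)"

definition mpc_minimizer ::
  "('x \<Rightarrow> 'u \<Rightarrow> 'x) \<Rightarrow> 'u set \<Rightarrow> ('x \<times> 'u) set \<Rightarrow> ('x \<Rightarrow> 'u \<Rightarrow> real) \<Rightarrow> ('x \<Rightarrow> 'u) \<Rightarrow>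
   nat \<Rightarrow> nat \<Rightarrow> 'x \<Rightarrow> (nat \<Rightarrow> 'u) \<Rightarrow> bool" where
  "mpc_minimizer f U Z l \<kappa> N M x u \<longleftrightarrow>
     u \<in> admissible f U Z N x \<and>
     (\<forall>v \<in> admissible f U Z N x. mpc_cost f Z l \<kappa> N M x u \<le> mpc_cost f Z l \<kappa> N M x v)"

definition inf_horizon_value ::
  "('x \<Rightarrow> 'u \<Rightarrow> 'x) \<Rightarrow> 'u set \<Rightarrow> ('x \<times> 'u) set \<Rightarrow> ('x \<Rightarrow> 'u \<Rightarrow> real) \<Rightarrow> 'x \<Rightarrow> ennreal" where
  "inf_horizon_value f U Z l x =
     (INF u \<in> {u. \<forall>k. u k \<in> U \<and> (open_loop f x u k, u k) \<in> Z}.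
        \<Sum>k. ennreal (l (open_loop f x u k) (u k)))"

text \<open>
  The feedback is prescribed only while the optimization problem is feasible; afterwards the
  input is arbitrary. Feasibility at all times is therefore not part of this definition but
  something to be proved. Minimizers need not be unique, so there may be several closed-loop
  trajectories from the same initial state.
\<close>

definition closed_loop ::
  "('x \<Rightarrow> 'u \<Rightarrow> 'x) \<Rightarrow> 'u set \<Rightarrow> ('x \<times> 'u) set \<Rightarrow> ('x \<Rightarrow> 'u \<Rightarrow> real) \<Rightarrow> ('x \<Rightarrow> 'u) \<Rightarrow>
   nat \<Rightarrow> nat \<Rightarrow> 'x \<Rightarrow> (nat \<Rightarrow> 'x) \<Rightarrow> (nat \<Rightarrow> 'u) \<Rightarrow> bool" where
  "closed_loop f U Z l \<kappa> N M x0 x u \<longleftrightarrow>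
     x 0 = x0 \<and> (\<forall>t. x (Suc t) = f (x t) (u t)) \<and>
     (\<forall>t. mpc_feasible f U Z l \<kappa> N M (x t) \<longrightarrow>
        (\<exists>v. mpc_minimizer f U Z l \<kappa> N M (x t) v \<and> u t = v 0))"

text \<open>
  Here \<open>traj x0 x\<close> means that \<open>x\<close> is a trajectory of the system starting at \<open>x0\<close>.
\<close>

definition origin_asymp_stable ::
  "'x::real_normed_vector set \<Rightarrow> ('x \<Rightarrow> (nat \<Rightarrow> 'x) \<Rightarrow> bool) \<Rightarrow> bool" where
  "origin_asymp_stable S traj \<longleftrightarrow>
     (\<forall>\<eta>>0. \<exists>\<delta>>0. \<forall>x0\<in>S. \<forall>x. traj x0 x \<longrightarrow> norm x0 \<le> \<delta> \<longrightarrow> (\<forall>t. norm (x t) \<le> \<eta>)) \<and>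
     (\<forall>x0\<in>S. \<forall>x. traj x0 x \<longrightarrow> x \<longlonglongrightarrow> 0)"

end

theory Submission
  imports Defs
begin

text \<open>
  Let \<open>\<gamma> = C / (1 - \<rho>)\<close> and \<open>\<Gamma> = max \<gamma> (V_bar / \<epsilon>)\<close>. Running \<open>\<kappa>\<close> from a state with
  \<open>\<ell>\<^sub>m\<^sub>i\<^sub>n \<le> \<epsilon>\<close> costs at most \<open>\<gamma> \<ell>\<^sub>m\<^sub>i\<^sub>n\<close>, whatever the horizon, and hence the value function is at
  most \<open>\<Gamma> \<ell>\<^sub>m\<^sub>i\<^sub>n\<close> on its sublevel set of level \<open>V_bar\<close>. Among the \<open>N - 1\<close> stages after the first
  of an optimal open-loop trajectory from \<open>x\<close>, the cheapest costs at most \<open>V(x) / (N - 1)\<close>, which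
  is at most \<open>\<epsilon>\<close> for large \<open>N\<close>. Following the optimal trajectory up to that stage and then
  switching to \<open>\<kappa>\<close> is admissible from the successor state, so that
  \<open>V(x\<^sup>+) \<le> V(x) - (1 - \<gamma> \<Gamma> / (N - 1)) \<ell>(x, u)\<close>. The value function is therefore a Lyapunov function,
  and everything follows by telescoping. The comparison with the infinite-horizon cost only needs
  \<open>V \<le> \<Gamma> \<ell>\<^sub>m\<^sub>i\<^sub>n \<le> \<Gamma> V\<^sub>\<infinity>\<close>.
\<close>

section \<open>Open-loop trajectories and switching to the feedback\<close>

lemma phi_x_add: "phi_x f \<kappa> (i + j) x = phi_x f \<kappa> j (phi_x f \<kappa> i x)"
  by (induction j) simp_all

lemma open_loop_Suc_shift:
  "open_loop f x u (Suc k) = open_loop f (f x (u 0)) (\<lambda>n. u (Suc n)) k"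
  by (induction k) simp_all

lemma open_loop_cong:
  "(\<And>i. i < k \<Longrightarrow> u i = v i) \<Longrightarrow> open_loop f x u k = open_loop f x v k"
  by (induction k) simp_all

text \<open>The sequence is not cut off at a horizon, so it serves every \<open>N \<ge> p\<close>.
  The feedback restarts at the state reached after \<open>p\<close> steps, hence the shift
  \<open>n - p\<close>.\<close>

definition switch_to ::
  "('x \<Rightarrow> 'u \<Rightarrow> 'x) \<Rightarrow> ('x \<Rightarrow> 'u) \<Rightarrow> 'x \<Rightarrow> (nat \<Rightarrow> 'u) \<Rightarrow> nat \<Rightarrow> nat \<Rightarrow> 'u" where
  "switch_to f \<kappa> x v p n = (if n < p then v n else phi_u f \<kappa> (n - p) (open_loop f x v p))"

lemma open_loop_switch_before:
  "k \<le> p \<Longrightarrow> open_loop f x (switch_to f \<kappa> x v p) k = open_loop f x v k"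
  by (rule open_loop_cong) (simp add: switch_to_def)

lemma open_loop_switch_after:
  "open_loop f x (switch_to f \<kappa> x v p) (p + j) = phi_x f \<kappa> j (open_loop f x v p)"
proof (induction j)
  case 0
  then show ?case by (simp add: open_loop_switch_before)
next
  case (Suc j)
  have "switch_to f \<kappa> x v p (p + j) = phi_u f \<kappa> j (open_loop f x v p)"
    by (simp add: switch_to_def)
  with Suc.IH show ?case by (simp add: phi_u_def)
qed

section \<open>Finite sums and averages\<close>

lemma sum_lessThan_add:
  fixes g :: "nat \<Rightarrow> 'a::comm_monoid_add"
  shows "sum g {..<p + n} = sum g {..<p} + (\<Sum>j<n. g (p + j))"
  by (induction n) (simp_all add: add.assoc)

text \<open>If every term exceeded the average, adding the \<open>n\<close> strict inequalities
  would give \<open>n\<close> times the sum on both sides.\<close>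

lemma exists_le_average:
  fixes a :: "nat \<Rightarrow> real"
  assumes "0 < n"
  shows "\<exists>p<n. real n * a p \<le> (\<Sum>i<n. a i)"
proof (rule ccontr)
  assume "\<not> ?thesis"
  then have "(\<Sum>i<n. (\<Sum>j<n. a j)) < (\<Sum>i<n. real n * a i)"
    using assms by (intro sum_strict_mono) auto
  then show False by (simp add: sum_distrib_left)
qed

section \<open>Comparison functions\<close>

lemma class_K_inf_nonneg: "class_K_inf \<alpha> \<Longrightarrow> 0 \<le> r \<Longrightarrow> 0 \<le> \<alpha> r"
  by (auto simp: class_K_inf_def)

lemma class_K_inf_less_iff:
  "class_K_inf \<alpha> \<Longrightarrow> 0 \<le> r \<Longrightarrow> 0 \<le> s \<Longrightarrow> \<alpha> r < \<alpha> s \<longleftrightarrow> r < s"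
  using strict_mono_on_less[of "{0..}" \<alpha> r s] by (simp add: class_K_inf_def)

lemma class_K_inf_le_iff:
  "class_K_inf \<alpha> \<Longrightarrow> 0 \<le> r \<Longrightarrow> 0 \<le> s \<Longrightarrow> \<alpha> r \<le> \<alpha> s \<longleftrightarrow> r \<le> s"
  by (meson class_K_inf_less_iff not_less)

lemma class_K_inf_pos: "class_K_inf \<alpha> \<Longrightarrow> 0 < r \<Longrightarrow> 0 < \<alpha> r"
  using class_K_inf_less_iff[of \<alpha> 0 r] by (simp add: class_K_inf_def)

lemma class_K_inf_small:
  assumes "class_K_inf \<alpha>" "0 < c"
  shows "\<exists>\<delta>>0. \<forall>r. 0 \<le> r \<longrightarrow> r \<le> \<delta> \<longrightarrow> \<alpha> r < c"
proof -
  have "continuous_on {0..} \<alpha>" "\<alpha> 0 = 0"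
    using assms(1) by (auto simp: class_K_inf_def)
  then obtain d where d: "d > 0" "\<And>r. r \<ge> 0 \<Longrightarrow> dist r 0 < d \<Longrightarrow> dist (\<alpha> r) 0 < c"
    using assms(2) unfolding continuous_on_iff by (metis atLeast_iff order_refl)
  have "\<alpha> r < c" if "0 \<le> r" "r \<le> d / 2" for r
    using d(2)[of r] that d(1) by auto
  then show ?thesis using d(1) by (intro exI[of _ "d / 2"]) auto
qed

text \<open>Strict monotonicity cancels \<open>\<alpha>\<close> in
  \<open>\<alpha> (norm (x t)) < \<alpha> e\<close>, which takes the place of continuity of an
  inverse.\<close>

lemma class_K_inf_tendsto_zeroD:
  fixes x :: "nat \<Rightarrow> 'a::real_normed_vector"
  assumes "class_K_inf \<alpha>" "(\<lambda>t. \<alpha> (norm (x t))) \<longlonglongrightarrow> 0"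
  shows "x \<longlonglongrightarrow> 0"
proof (rule tendstoI)
  fix e :: real assume "e > 0"
  then have "eventually (\<lambda>t. \<alpha> (norm (x t)) < \<alpha> e) sequentially"
    using order_tendstoD(2)[OF assms(2) class_K_inf_pos[OF assms(1)]] by simp
  then show "eventually (\<lambda>t. dist (x t) 0 < e) sequentially"
    using \<open>e > 0\<close> by (simp add: class_K_inf_less_iff[OF assms(1)])
qed

section \<open>Bounds on the value function from a local feedback\<close>

text \<open>Exponential decay enters only in summed form, as a bound on the cost of a
  \<open>\<kappa>\<close> run. Its uniformity in the length \<open>n\<close> makes the later bounds
  independent of \<open>M\<close>.\<close>

locale local_feedback =
  fixes f :: "'x \<Rightarrow> 'u \<Rightarrow> 'x" and U :: "'u set" and Z :: "('x \<times> 'u) set"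
    and l :: "'x \<Rightarrow> 'u \<Rightarrow> real" and \<kappa> :: "'x \<Rightarrow> 'u" and \<gamma> \<epsilon> :: real
  assumes l_nonneg: "u \<in> U \<Longrightarrow> 0 \<le> l x u"
    and \<kappa>_range: "\<kappa> x \<in> U"
    and \<gamma>_ge_1: "1 \<le> \<gamma>"
    and \<epsilon>_pos: "0 < \<epsilon>"
    and feedback_cost: "stage_min U l x \<le> \<epsilon> \<Longrightarrow>
      (\<Sum>j<n. stage_fb l \<kappa> (phi_x f \<kappa> j x)) \<le> \<gamma> * stage_min U l x"
    and feedback_Z: "stage_min U l x \<le> \<epsilon> \<Longrightarrow> (phi_x f \<kappa> k x, phi_u f \<kappa> k x) \<in> Z"
begin

abbreviation "lmin \<equiv> stage_min U l"
abbreviation "V \<equiv> mpc_value f U Z l \<kappa>"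

lemma lmin_le: "u \<in> U \<Longrightarrow> lmin x \<le> l x u"
  unfolding stage_min_def by (rule cINF_lower) (auto intro!: bdd_belowI[of _ 0] l_nonneg)

lemma lmin_nonneg: "0 \<le> lmin x"
  unfolding stage_min_def using \<kappa>_range by (intro cINF_greatest) (auto intro: l_nonneg)

text \<open>The tail cost is itself the cost of a \<open>\<kappa>\<close> run. After step
  \<open>p\<close> the remaining \<open>N - p\<close> stages and the \<open>M\<close> tail stages
  therefore form one run from the switching state, to which \<open>feedback_cost\<close>
  applies.\<close>

lemma value_switch_le:
  assumes "p \<le> N" "v \<in> admissible f U Z p x" "lmin (open_loop f x v p) \<le> \<epsilon>"
  shows "V N M x \<le> (\<Sum>i<p. ennreal (l (open_loop f x v i) (v i)))
    + ennreal (\<gamma> * lmin (open_loop f x v p))"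
proof -
  define z where "z = open_loop f x v p"
  define w where "w = switch_to f \<kappa> x v p"
  define g where "g j = ennreal (stage_fb l \<kappa> (phi_x f \<kappa> j z))" for j
  have z: "lmin z \<le> \<epsilon>" using assms(3) by (simp add: z_def)
  have before: "open_loop f x w i = open_loop f x v i" "w i = v i" if "i < p" for i
    using that open_loop_switch_before[of i p f x \<kappa> v] by (simp_all add: w_def switch_to_def)
  have after: "open_loop f x w (p + j) = phi_x f \<kappa> j z" "w (p + j) = phi_u f \<kappa> j z" for j
    by (simp_all add: w_def z_def open_loop_switch_after) (simp add: switch_to_def)
  obtain n where N: "N = p + n" using assms(1) le_Suc_ex by blast
  have "w k \<in> U \<and> (open_loop f x w k, w k) \<in> Z" for k
  proof (cases "k < p")
    case True
    then show ?thesis using assms(2) before by (auto simp: admissible_def)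
  next
    case False
    then obtain j where "k = p + j" by (metis le_Suc_ex not_less)
    then show ?thesis using feedback_Z[OF z] after by (simp add: phi_u_def \<kappa>_range)
  qed
  then have "w \<in> admissible f U Z N x" by (simp add: admissible_def)
  then have "V N M x \<le> mpc_cost f Z l \<kappa> N M x w"
    unfolding mpc_value_def by (rule INF_lower)
  \<comment> \<open>As \<open>n = N - p\<close>, the tail begins \<open>n\<close> steps into the run
    from \<open>z\<close> and continues its numbering.\<close>
  also have "tail_cost f Z l \<kappa> M (open_loop f x w N) = (\<Sum>j<M. g (n + j))"
    using feedback_Z[OF z]
    by (simp add: N after tail_cost_def phi_u_def g_def phi_x_add[symmetric])
  then have "mpc_cost f Z l \<kappa> N M x w
      = (\<Sum>i<p. ennreal (l (open_loop f x v i) (v i))) + (\<Sum>j<n + M. g j)"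
    by (simp add: mpc_cost_def N sum_lessThan_add before after g_def phi_u_def stage_fb_def add.assoc)
  also have "(\<Sum>j<n + M. g j) = ennreal (\<Sum>j<n + M. stage_fb l \<kappa> (phi_x f \<kappa> j z))"
    unfolding g_def by (rule sum_ennreal) (simp add: stage_fb_def l_nonneg \<kappa>_range)
  also have "\<dots> \<le> ennreal (\<gamma> * lmin z)"
    by (rule ennreal_leI) (rule feedback_cost[OF z])
  finally show ?thesis by (simp add: z_def)
qed

text \<open>Near the origin the feedback is applied from the start; elsewhere
  \<open>lmin x > \<epsilon>\<close>, so the level \<open>v\<close> itself is at most
  \<open>v / \<epsilon> * lmin x\<close>.\<close>

lemma value_le_lmin:
  assumes "V N M x \<le> ennreal v" "0 \<le> v"
  shows "V N M x \<le> ennreal (max \<gamma> (v / \<epsilon>) * lmin x)"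
proof (cases "lmin x \<le> \<epsilon>")
  case True
  \<comment> \<open>Switching at \<open>p = 0\<close> reads no entry of the preceding input
    sequence, so \<open>undefined\<close> will do.\<close>
  then have "V N M x \<le> ennreal (\<gamma> * lmin x)"
    using value_switch_le[of 0 N undefined x M] by (simp add: admissible_def)
  also have "\<dots> \<le> ennreal (max \<gamma> (v / \<epsilon>) * lmin x)"
    by (intro ennreal_leI mult_right_mono lmin_nonneg) simp
  finally show ?thesis .
next
  case False
  have "v = v / \<epsilon> * \<epsilon>" using \<epsilon>_pos by simp
  also have "\<dots> \<le> max \<gamma> (v / \<epsilon>) * lmin x"
    using False \<epsilon>_pos \<gamma>_ge_1 assms(2) by (intro mult_mono) auto
  finally show ?thesis using assms(1) by (meson ennreal_leI order_trans)
qed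

lemma stage_le_value:
  assumes "1 \<le> N" "mpc_minimizer f U Z l \<kappa> N M x v"
  shows "ennreal (l x (v 0)) \<le> V N M x"
  unfolding mpc_value_def
proof (rule INF_greatest)
  fix w assume w: "w \<in> admissible f U Z N x"
  have "ennreal (l x (v 0)) \<le> (\<Sum>k<N. ennreal (l (open_loop f x v k) (v k)))"
    using member_le_sum[of 0 "{..<N}" "\<lambda>k. ennreal (l (open_loop f x v k) (v k))"] assms(1) by simp
  also have "\<dots> \<le> mpc_cost f Z l \<kappa> N M x v"
    by (simp add: mpc_cost_def)
  also have "\<dots> \<le> mpc_cost f Z l \<kappa> N M x w"
    using assms(2) w by (simp add: mpc_minimizer_def)
  finally show "ennreal (l x (v 0)) \<le> mpc_cost f Z l \<kappa> N M x w" .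
qed

lemma feasible_iff: "mpc_feasible f U Z l \<kappa> N M x \<longleftrightarrow> V N M x < \<infinity>"
  by (auto simp: mpc_feasible_def mpc_value_def INF_less_iff)

lemma value_minimizer:
  assumes "mpc_minimizer f U Z l \<kappa> N M x v"
  shows "V N M x = mpc_cost f Z l \<kappa> N M x v"
  using assms unfolding mpc_value_def mpc_minimizer_def
  by (intro antisym INF_lower INF_greatest) auto

text \<open>Of the optimal cost, stages \<open>1\<close> to \<open>p\<close> are kept, while stage
  \<open>0\<close> and everything from stage \<open>p + 1\<close> on are given up. The new
  \<open>\<kappa>\<close> run costs at most a fraction of stage \<open>0\<close>; the factor on
  \<open>l x (u 0)\<close> is what remains of it.\<close>

lemma value_decrease:
  assumes N: "1 < N" and v: "0 \<le> v" "v \<le> (real N - 1) * \<epsilon>"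
    and x: "V N M x \<le> ennreal v" and u: "mpc_minimizer f U Z l \<kappa> N M x u"
    and le1: "\<gamma> * max \<gamma> (v / \<epsilon>) \<le> real N - 1"
  shows "V N M (f x (u 0))
    + ennreal ((1 - \<gamma> * max \<gamma> (v / \<epsilon>) / (real N - 1)) * l x (u 0)) \<le> V N M x"
proof -
  define \<Gamma> where "\<Gamma> = max \<gamma> (v / \<epsilon>)"
  define a where "a k = l (open_loop f x u k) (u k)" for k
  \<comment> \<open>Here \<open>q\<close> is the fraction lost; in the locale
    \<open>mpc_closed_loop\<close> the same letter denotes one minus it.\<close>
  define q where "q = \<gamma> * \<Gamma> / (real N - 1)"
  have adm: "u \<in> admissible f U Z N x" using u by (simp add: mpc_minimizer_def)
  then have uU: "u k \<in> U" "(open_loop f x u k, u k) \<in> Z" if "k < N" for k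
    using that by (auto simp: admissible_def)
  \<comment> \<open>Entries of \<open>u\<close> from \<open>N\<close> on may lie outside
    \<open>U\<close>, hence the restriction.\<close>
  then have a_nonneg: "0 \<le> a k" if "k < N" for k
    using that by (simp add: a_def l_nonneg)
  obtain n where n: "N = Suc n" "0 < n" using N by (cases N) auto
  obtain r where r: "V N M x = ennreal r" "0 \<le> r"
    using x by (cases "V N M x") (auto simp: top_unique)
  have "r \<le> v" using x r v(1) by simp
  have sums: "(\<Sum>k<m. ennreal (a k)) = ennreal (\<Sum>k<m. a k)" if "m \<le> N" for m
    using that by (intro sum_ennreal) (auto intro: a_nonneg)
  have "ennreal (\<Sum>k<N. a k) \<le> V N M x"
    unfolding value_minimizer[OF u] mpc_cost_def sums[OF order_refl, symmetric] by (simp add: a_def)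
  then have r_ge: "(\<Sum>k<N. a k) \<le> r" using r by (simp add: ennreal_le_iff)
  \<comment> \<open>The average runs over the \<open>n = N - 1\<close> stages after stage
    \<open>0\<close>, which the successor state has already passed.\<close>
  obtain p where p: "p < n" "real n * a (Suc p) \<le> (\<Sum>i<n. a (Suc i))"
    using exists_le_average[OF n(2), of "\<lambda>i. a (Suc i)"] by auto
  define z where "z = open_loop f x u (Suc p)"
  have "lmin z \<le> a (Suc p)"
    using uU(1)[of "Suc p"] p(1) n by (simp add: a_def z_def lmin_le del: open_loop.simps)
  moreover have "(\<Sum>i<n. a (Suc i)) \<le> (\<Sum>k<N. a k)"
    using a_nonneg[of 0] N unfolding n(1) sum.lessThan_Suc_shift by simp
  ultimately have zr: "real n * lmin z \<le> r"
    using p(2) r_ge mult_left_mono[of "lmin z" "a (Suc p)" "real n"] by linarith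
  \<comment> \<open>The bound on \<open>v\<close> puts the cheapest stage in the region where
    \<open>\<kappa>\<close> may take over.\<close>
  have "real n * lmin z \<le> real n * \<epsilon>"
    using zr \<open>r \<le> v\<close> v(2) n(1) by simp
  then have z: "lmin z \<le> \<epsilon>" using n(2) by simp
  \<comment> \<open>This measures the whole optimal cost by its stage \<open>0\<close>, so that the
    cost of the \<open>\<kappa>\<close> run can be charged to that stage.\<close>
  have r_le: "r \<le> \<Gamma> * a 0"
  proof -
    have "ennreal r \<le> ennreal (\<Gamma> * lmin x)"
      using value_le_lmin[OF x v(1)] r by (simp add: \<Gamma>_def)
    then have "r \<le> \<Gamma> * lmin x"
      using \<gamma>_ge_1 by (subst (asm) ennreal_le_iff) (auto simp: \<Gamma>_def lmin_nonneg)
    also have "\<dots> \<le> \<Gamma> * a 0"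
      using uU(1)[of 0] N \<gamma>_ge_1 by (intro mult_left_mono) (auto simp: a_def lmin_le \<Gamma>_def)
    finally show ?thesis .
  qed
  have "real n * (\<gamma> * lmin z) \<le> \<gamma> * r"
    using mult_left_mono[OF zr, of \<gamma>] \<gamma>_ge_1 by (simp add: mult.left_commute)
  also have "\<dots> \<le> \<gamma> * (\<Gamma> * a 0)"
    using r_le \<gamma>_ge_1 by (intro mult_left_mono) auto
  finally have zq: "\<gamma> * lmin z \<le> q * a 0"
    using n by (simp add: q_def field_simps)
  have q: "0 \<le> q" "q \<le> 1"
    using le1 \<gamma>_ge_1 n by (simp_all add: q_def \<Gamma>_def)
  have shift: "open_loop f (f x (u 0)) (\<lambda>k. u (Suc k)) i = open_loop f x u (Suc i)" for i
    by (rule open_loop_Suc_shift[symmetric])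
  have "(\<lambda>k. u (Suc k)) \<in> admissible f U Z p (f x (u 0))"
    using uU p(1) n by (simp add: admissible_def shift del: open_loop.simps)
  then have "V N M (f x (u 0)) \<le> (\<Sum>i<p. ennreal (a (Suc i))) + ennreal (\<gamma> * lmin z)"
    using value_switch_le[of p N "\<lambda>k. u (Suc k)" "f x (u 0)" M] p(1) n z
    unfolding shift a_def z_def by (simp del: open_loop.simps)
  also have "(\<Sum>i<p. ennreal (a (Suc i))) = ennreal (\<Sum>i<p. a (Suc i))"
    using p(1) n by (intro sum_ennreal) (auto intro: a_nonneg)
  finally have "V N M (f x (u 0)) + ennreal ((1 - q) * a 0)
      \<le> ennreal (\<Sum>i<p. a (Suc i)) + ennreal (\<gamma> * lmin z) + ennreal ((1 - q) * a 0)"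
    by (rule add_right_mono)
  \<comment> \<open>Merging requires nonnegative summands, because \<open>ennreal\<close> truncates;
    for the last one this uses \<open>q \<le> 1\<close>.\<close>
  also have "\<dots> = ennreal ((\<Sum>i<p. a (Suc i)) + \<gamma> * lmin z + (1 - q) * a 0)"
  proof -
    have "0 \<le> (\<Sum>i<p. a (Suc i))"
      using p(1) n by (intro sum_nonneg) (auto intro: a_nonneg)
    moreover have "0 \<le> \<gamma> * lmin z" "0 \<le> (1 - q) * a 0"
      using \<gamma>_ge_1 q a_nonneg[of 0] N by (simp_all add: lmin_nonneg)
    ultimately show ?thesis by (simp add: ennreal_plus)
  qed
  also have "\<dots> \<le> ennreal r"
  proof (rule ennreal_leI)
    \<comment> \<open>The loss \<open>q * a 0\<close> cancels against the weight
      \<open>1 - q\<close>, leaving stages \<open>0\<close> to \<open>p\<close>, a part of the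
      optimal cost.\<close>
    have "(\<Sum>i<p. a (Suc i)) + a 0 = (\<Sum>i<Suc p. a i)"
      by (simp only: sum.lessThan_Suc_shift add.commute)
    also have "\<dots> \<le> (\<Sum>k<N. a k)"
      using p(1) n by (intro sum_mono2) (auto intro: a_nonneg)
    finally show "(\<Sum>i<p. a (Suc i)) + \<gamma> * lmin z + (1 - q) * a 0 \<le> r"
      using zq r_ge by (simp add: left_diff_distrib)
  qed
  finally show ?thesis by (simp add: r(1) q_def \<Gamma>_def a_def)
qed

lemma lmin_le_inf_horizon_value: "ennreal (lmin x) \<le> inf_horizon_value f U Z l x"
  unfolding inf_horizon_value_def
proof (rule INF_greatest)
  fix u assume "u \<in> {u. \<forall>k. u k \<in> U \<and> (open_loop f x u k, u k) \<in> Z}"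
  then have "lmin x \<le> l x (u 0)" by (simp add: lmin_le)
  then have "ennreal (lmin x) \<le> (\<Sum>k<1. ennreal (l (open_loop f x u k) (u k)))"
    by (simp add: ennreal_leI)
  also have "\<dots> \<le> (\<Sum>k. ennreal (l (open_loop f x u k) (u k)))"
    by (rule sum_le_suminf) auto
  finally show "ennreal (lmin x) \<le> (\<Sum>k. ennreal (l (open_loop f x u k) (u k)))" .
qed

end

section \<open>Closed-loop trajectories\<close>

locale mpc_closed_loop = local_feedback +
  fixes N M :: nat and v :: real
  assumes N_gt: "1 < N" and v_nonneg: "0 \<le> v" and v_le: "v \<le> (real N - 1) * \<epsilon>"
    and gain_less: "\<gamma> * max \<gamma> (v / \<epsilon>) < real N - 1"
begin

text \<open>The fraction of each stage cost by which the value is guaranteed to drop;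
  \<open>gain_less\<close> makes it positive.\<close>

definition "q = 1 - \<gamma> * max \<gamma> (v / \<epsilon>) / (real N - 1)"

lemma q_bounds: "0 < q" "q \<le> 1"
  using gain_less \<gamma>_ge_1 N_gt by (simp_all add: q_def)

context
  fixes x0 :: 'a and x :: "nat \<Rightarrow> 'a" and u :: "nat \<Rightarrow> 'b"
  assumes start: "V N M x0 \<le> ennreal v"
    and cl: "closed_loop f U Z l \<kappa> N M x0 x u"
begin

lemma minimizer_at:
  assumes "V N M (x t) \<le> ennreal v"
  obtains w where "mpc_minimizer f U Z l \<kappa> N M (x t) w" "u t = w 0"
proof -
  have "mpc_feasible f U Z l \<kappa> N M (x t)"
    unfolding feasible_iff using assms by (rule order_le_less_trans) simp
  then show ?thesis using cl that by (auto simp: closed_loop_def)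
qed

lemma value_step:
  assumes "V N M (x t) \<le> ennreal v"
  shows "V N M (x (Suc t)) + ennreal (q * l (x t) (u t)) \<le> V N M (x t)"
proof -
  obtain w where w: "mpc_minimizer f U Z l \<kappa> N M (x t) w" "u t = w 0"
    using minimizer_at[OF assms] .
  then show ?thesis
    using value_decrease[OF N_gt v_nonneg v_le assms w(1)] gain_less cl
    by (simp add: q_def closed_loop_def)
qed

text \<open>The steps are added up with the accumulated cost kept on the left, which avoids
  truncated subtraction in \<open>ennreal\<close>.\<close>

lemma telescoped: "V N M (x t) + (\<Sum>k<t. ennreal (q * l (x k) (u k))) \<le> V N M x0"
proof (induction t)
  case 0
  then show ?case using cl by (simp add: closed_loop_def)
next
  case (Suc t)
  \<comment> \<open>Invariance of the sublevel set comes from the induction hypothesis: dropping the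
    sum bounds the value at \<open>x t\<close>, which licenses the next step.\<close>
  have "V N M (x t) \<le> V N M x0"
    using Suc.IH by (rule order_trans[rotated]) simp
  then have "V N M (x (Suc t)) + ennreal (q * l (x t) (u t)) \<le> V N M (x t)"
    using start by (intro value_step) (rule order_trans)
  then have "V N M (x (Suc t)) + ennreal (q * l (x t) (u t)) + (\<Sum>k<t. ennreal (q * l (x k) (u k)))
      \<le> V N M (x t) + (\<Sum>k<t. ennreal (q * l (x k) (u k)))"
    by (rule add_right_mono)
  also note Suc.IH
  finally show ?case by (simp add: ac_simps)
qed

lemma value_le_start: "V N M (x t) \<le> V N M x0"
  using telescoped[of t] by (rule order_trans[rotated]) simp

lemma value_le_level: "V N M (x t) \<le> ennreal v"
  using value_le_start start by (rule order_trans)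

lemma feasible_at: "mpc_feasible f U Z l \<kappa> N M (x t)"
  unfolding feasible_iff using value_le_level by (rule order_le_less_trans) simp

lemma constraints_at: "u t \<in> U" "(x t, u t) \<in> Z"
proof -
  obtain w where "mpc_minimizer f U Z l \<kappa> N M (x t) w" "u t = w 0"
    using minimizer_at[OF value_le_level] .
  then show "u t \<in> U" "(x t, u t) \<in> Z"
    using N_gt by (force simp: mpc_minimizer_def admissible_def)+
qed

lemma lmin_le_value: "ennreal (lmin (x t)) \<le> V N M (x t)"
proof -
  obtain w where w: "mpc_minimizer f U Z l \<kappa> N M (x t) w" "u t = w 0"
    using minimizer_at[OF value_le_level] .
  have "ennreal (lmin (x t)) \<le> ennreal (l (x t) (u t))"
    by (intro ennreal_leI lmin_le constraints_at)
  also have "\<dots> \<le> V N M (x t)"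
    using stage_le_value[OF _ w(1)] w(2) N_gt by simp
  finally show ?thesis .
qed

text \<open>Dropping \<open>V N M (x t)\<close> from \<open>telescoped\<close> bounds all partial
  sums uniformly.\<close>

lemma closed_loop_cost: "(\<Sum>k. ennreal (l (x k) (u k))) \<le> ennreal (1 / q) * V N M x0"
proof -
  have "(\<Sum>k<n. ennreal (l (x k) (u k))) \<le> ennreal (1 / q) * V N M x0" for n
  proof -
    have "(\<Sum>k<n. ennreal (l (x k) (u k)))
        = ennreal (1 / q) * (\<Sum>k<n. ennreal (q * l (x k) (u k)))"
      unfolding sum_distrib_left
      using q_bounds by (intro sum.cong refl)
        (simp add: ennreal_mult[symmetric] l_nonneg constraints_at(1))
    also have "\<dots> \<le> ennreal (1 / q) * V N M x0"
      using telescoped[of n] by (intro mult_left_mono) (auto elim: order_trans[rotated])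
    finally show ?thesis .
  qed
  then show ?thesis by (intro suminf_le_const) auto
qed

text \<open>A finite total cost forces the stage costs to vanish, and they dominate
  \<open>lmin\<close>.\<close>

lemma lmin_tendsto_zero: "(\<lambda>t. lmin (x t)) \<longlonglongrightarrow> 0"
proof -
  have "(\<Sum>k. ennreal (l (x k) (u k))) \<le> ennreal (1 / q) * ennreal v"
    using closed_loop_cost start by (meson mult_left_mono order_trans zero_le)
  also have "\<dots> < top"
    by (simp add: ennreal_mult_less_top)
  finally have "summable (\<lambda>k. l (x k) (u k))"
    using l_nonneg constraints_at(1) by (intro summable_suminf_not_top) auto
  then have "(\<lambda>k. l (x k) (u k)) \<longlonglongrightarrow> 0" by (rule summable_LIMSEQ_zero)
  then show ?thesis
    by (rule Lim_null_comparison[rotated])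
      (simp add: lmin_nonneg lmin_le[OF constraints_at(1)])
qed

end

end

section \<open>Choice of constants, stability and performance\<close>

theorem theorem5:
  fixes f :: "real ^ 'n \<Rightarrow> real ^ 'm \<Rightarrow> real ^ 'n"
    and U :: "(real ^ 'm) set"
    and Z :: "((real ^ 'n) \<times> (real ^ 'm)) set"
    and l :: "real ^ 'n \<Rightarrow> real ^ 'm \<Rightarrow> real"
    and \<kappa> :: "real ^ 'n \<Rightarrow> real ^ 'm"
  assumes U_compact: "compact U"
    and f_cont: "continuous_on (UNIV \<times> U) (\<lambda>(x, u). f x u)"
    and l_cont: "continuous_on (UNIV \<times> U) (\<lambda>(x, u). l x u)"
    and l_nonneg: "\<And>x u. u \<in> U \<Longrightarrow> 0 \<le> l x u"
    and f_zero: "f 0 0 = 0"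
    and Z_sub: "Z \<subseteq> UNIV \<times> U"
    and Z_int: "(0, 0) \<in> interior Z"
    and \<kappa>_cont: "continuous_on UNIV \<kappa>"
    and \<kappa>_range: "\<And>x. \<kappa> x \<in> U"
    and minimizers_exist: "\<And>N M x. N \<ge> 1 \<Longrightarrow> M \<ge> 1 \<Longrightarrow> mpc_feasible f U Z l \<kappa> N M x \<Longrightarrow>
           \<exists>u. mpc_minimizer f U Z l \<kappa> N M x u"
    and A1: "\<exists>\<alpha>_lo \<alpha>_up. class_K_inf \<alpha>_lo \<and> class_K_inf \<alpha>_up \<and>
           (\<forall>x. \<alpha>_lo (norm x) \<le> stage_min U l x \<and> stage_min U l x \<le> \<alpha>_up (norm x))"
    and A1_zero: "l 0 0 = 0"
    and A2: "\<exists>\<rho> C \<epsilon>. 0 \<le> \<rho> \<and> \<rho> < 1 \<and> C \<ge> 1 \<and> \<epsilon> > 0 \<and>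
           (\<forall>x. stage_min U l x \<le> \<epsilon> \<longrightarrow>
              (\<forall>k::nat. stage_fb l \<kappa> (phi_x f \<kappa> k x) \<le> C * \<rho> ^ k * stage_min U l x \<and>
                 (phi_x f \<kappa> k x, phi_u f \<kappa> k x) \<in> Z))"
  shows "\<forall>V_bar::real. V_bar > 0 \<longrightarrow> (\<forall>M\<ge>1. \<exists>N_bar::real. N_bar \<ge> 0 \<and>
     (\<forall>N\<ge>1. real N > N_bar \<longrightarrow>
       (let X = {x. mpc_value f U Z l \<kappa> N M x \<le> ennreal V_bar} in
         (\<forall>x0\<in>X. \<forall>x u. closed_loop f U Z l \<kappa> N M x0 x u \<longrightarrow>
            (\<forall>t. mpc_feasible f U Z l \<kappa> N M (x t)) \<and> (\<forall>t. (x t, u t) \<in> Z)) \<and>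
         origin_asymp_stable X (\<lambda>x0 x. \<exists>u. closed_loop f U Z l \<kappa> N M x0 x u) \<and>
         (\<exists>\<alpha> \<epsilon>. 0 < \<alpha> \<and> \<alpha> \<le> 1 \<and> 0 < \<epsilon> \<and> \<epsilon> \<le> 1 \<and>
            (\<forall>x0\<in>X. \<forall>x u. closed_loop f U Z l \<kappa> N M x0 x u \<longrightarrow>
               (\<Sum>k. ennreal (l (x k) (u k))) \<le> ennreal (1 / \<epsilon>) * mpc_value f U Z l \<kappa> N M x0 \<and>
               ennreal (1 / \<epsilon>) * mpc_value f U Z l \<kappa> N M x0
                 \<le> ennreal (1 / \<alpha>) * inf_horizon_value f U Z l x0)))))"
proof -
  obtain \<alpha>_lo \<alpha>_up where K: "class_K_inf \<alpha>_lo" "class_K_inf \<alpha>_up"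
    and lo: "\<And>x. \<alpha>_lo (norm x) \<le> stage_min U l x"
    and up: "\<And>x. stage_min U l x \<le> \<alpha>_up (norm x)"
    using A1 by blast
  obtain \<rho> C \<epsilon> where \<rho>: "0 \<le> \<rho>" "\<rho> < 1" "C \<ge> 1" "\<epsilon> > 0"
    and decay: "\<And>x k. stage_min U l x \<le> \<epsilon> \<Longrightarrow>
        stage_fb l \<kappa> (phi_x f \<kappa> k x) \<le> C * \<rho> ^ k * stage_min U l x"
    and inZ: "\<And>x k. stage_min U l x \<le> \<epsilon> \<Longrightarrow> (phi_x f \<kappa> k x, phi_u f \<kappa> k x) \<in> Z"
    using A2 by blast
  \<comment> \<open>The sum of the series \<open>C * \<rho> ^ k\<close>; it is at least
    \<open>1\<close> since \<open>C \<ge> 1\<close> and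
    \<open>0 < 1 - \<rho> \<le> 1\<close>.\<close>
  define \<gamma> where "\<gamma> = C / (1 - \<rho>)"
  have lmin_nonneg: "0 \<le> stage_min U l x" for x
    using lo[of x] class_K_inf_nonneg[OF K(1), of "norm x"] by simp
  have geometric: "(\<Sum>j<n. \<rho> ^ j) \<le> 1 / (1 - \<rho>)" for n
    using sum_le_suminf[of "\<lambda>j. \<rho> ^ j" "{..<n}"] \<rho>
    by (simp add: suminf_geometric summable_geometric)
  have lf: "local_feedback f U Z l \<kappa> \<gamma> \<epsilon>"
  proof
    fix x n assume x: "stage_min U l x \<le> \<epsilon>"
    have "(\<Sum>j<n. stage_fb l \<kappa> (phi_x f \<kappa> j x)) \<le> (\<Sum>j<n. C * \<rho> ^ j * stage_min U l x)"
      by (intro sum_mono decay x)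
    also have "\<dots> = C * stage_min U l x * (\<Sum>j<n. \<rho> ^ j)"
      by (simp add: sum_distrib_left mult_ac)
    also have "\<dots> \<le> C * stage_min U l x * (1 / (1 - \<rho>))"
      using \<rho> lmin_nonneg geometric by (intro mult_left_mono) auto
    finally show "(\<Sum>j<n. stage_fb l \<kappa> (phi_x f \<kappa> j x)) \<le> \<gamma> * stage_min U l x"
      by (simp add: \<gamma>_def)
  qed (use \<rho> l_nonneg \<kappa>_range inZ in \<open>auto simp: \<gamma>_def field_simps\<close>)
  then interpret local_feedback f U Z l \<kappa> \<gamma> \<epsilon> .
  show ?thesis
  proof (intro allI impI)
    fix v :: real and M :: nat
    assume v: "v > 0"
    define \<Gamma> where "\<Gamma> = max \<gamma> (v / \<epsilon>)"
    have \<Gamma>: "\<Gamma> \<ge> 1" using \<gamma>_ge_1 by (simp add: \<Gamma>_def)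
    have \<Gamma>_nonneg: "0 \<le> \<gamma> * \<Gamma>" using \<Gamma> \<gamma>_ge_1 by simp
    show "\<exists>N_bar::real. N_bar \<ge> 0 \<and> (\<forall>N\<ge>1. real N > N_bar \<longrightarrow>
       (let X = {x. V N M x \<le> ennreal v} in
         (\<forall>x0\<in>X. \<forall>x u. closed_loop f U Z l \<kappa> N M x0 x u \<longrightarrow>
            (\<forall>t. mpc_feasible f U Z l \<kappa> N M (x t)) \<and> (\<forall>t. (x t, u t) \<in> Z)) \<and>
         origin_asymp_stable X (\<lambda>x0 x. \<exists>u. closed_loop f U Z l \<kappa> N M x0 x u) \<and>
         (\<exists>\<alpha> \<epsilon>. 0 < \<alpha> \<and> \<alpha> \<le> 1 \<and> 0 < \<epsilon> \<and> \<epsilon> \<le> 1 \<and>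
            (\<forall>x0\<in>X. \<forall>x u. closed_loop f U Z l \<kappa> N M x0 x u \<longrightarrow>
               (\<Sum>k. ennreal (l (x k) (u k))) \<le> ennreal (1 / \<epsilon>) * V N M x0 \<and>
               ennreal (1 / \<epsilon>) * V N M x0 \<le> ennreal (1 / \<alpha>) * inf_horizon_value f U Z l x0))))"
    \<comment> \<open>Two demands are met by adding them: \<open>\<gamma> * \<Gamma> < N - 1\<close>
      for a positive decrease, and \<open>v / \<epsilon> \<le> N - 1\<close> for a cheapest stage
      below \<open>\<epsilon>\<close>. The threshold does not depend on \<open>M\<close>.\<close>
    proof (intro exI[of _ "1 + \<gamma> * \<Gamma> + v / \<epsilon>"] conjI allI impI)
      show "0 \<le> 1 + \<gamma> * \<Gamma> + v / \<epsilon>"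
        using \<Gamma>_nonneg v \<rho> by simp
      fix N :: nat
      assume N: "1 + \<gamma> * \<Gamma> + v / \<epsilon> < real N"
      have v\<epsilon>: "0 \<le> v / \<epsilon>" using v \<rho> by simp
      have "v / \<epsilon> \<le> real N - 1" using N \<Gamma>_nonneg by linarith
      then have v_le: "v \<le> (real N - 1) * \<epsilon>" using \<rho> by (simp add: field_simps)
      have "1 < real N" and gain: "\<gamma> * \<Gamma> < real N - 1"
        using N \<Gamma>_nonneg v\<epsilon> by linarith+
      then have N_gt: "1 < N" by simp
      have "mpc_closed_loop f U Z l \<kappa> \<gamma> \<epsilon> N v"
        by unfold_locales (use v v_le gain N_gt in \<open>simp_all add: \<Gamma>_def\<close>)
      then interpret mpc_closed_loop f U Z l \<kappa> \<gamma> \<epsilon> N M v .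
      define X where "X = {x. V N M x \<le> ennreal v}"
      have V_le: "V N M x \<le> ennreal (\<Gamma> * lmin x)" if "x \<in> X" for x
        using value_le_lmin[of N M x v] that v by (simp add: X_def \<Gamma>_def)
      \<comment> \<open>The radius \<open>\<delta>\<close> is chosen for the chain
        \<open>\<alpha>_lo (norm (x t)) \<le> lmin (x t) \<le> V N M x0 \<le> \<Gamma> * lmin x0
        \<le> \<Gamma> * \<alpha>_up (norm x0)\<close> to end at most at
        \<open>\<alpha>_lo \<eta>\<close>.\<close>
      have stable: "\<exists>\<delta>>0. \<forall>x0\<in>X. \<forall>x. (\<exists>u. closed_loop f U Z l \<kappa> N M x0 x u) \<longrightarrow>
          norm x0 \<le> \<delta> \<longrightarrow> (\<forall>t. norm (x t) \<le> \<eta>)" if \<eta>: "\<eta> > 0" for \<eta>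
      proof -
        have "0 < \<alpha>_lo \<eta> / \<Gamma>" using class_K_inf_pos[OF K(1) \<eta>] \<Gamma> by simp
        then obtain \<delta> where \<delta>: "\<delta> > 0" "\<And>r. 0 \<le> r \<Longrightarrow> r \<le> \<delta> \<Longrightarrow> \<alpha>_up r < \<alpha>_lo \<eta> / \<Gamma>"
          using class_K_inf_small[OF K(2)] by meson
        have "norm (x t) \<le> \<eta>"
          if x0: "x0 \<in> X" "closed_loop f U Z l \<kappa> N M x0 x u" "norm x0 \<le> \<delta>" for x0 x u t
        proof -
          have start: "V N M x0 \<le> ennreal v" using x0 by (simp add: X_def)
          have "ennreal (lmin (x t)) \<le> V N M x0"
            using lmin_le_value[OF start x0(2)] value_le_start[OF start x0(2)]
            by (rule order_trans)
          also have "\<dots> \<le> ennreal (\<Gamma> * lmin x0)" by (rule V_le[OF x0(1)])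
          finally have "lmin (x t) \<le> \<Gamma> * lmin x0"
            using \<Gamma> lmin_nonneg[of x0] by (simp add: ennreal_le_iff)
          also have "\<dots> \<le> \<Gamma> * (\<alpha>_lo \<eta> / \<Gamma>)"
            using \<Gamma> up[of x0] \<delta>(2)[of "norm x0"] x0(3) by (intro mult_left_mono) auto
          finally have "\<alpha>_lo (norm (x t)) \<le> \<alpha>_lo \<eta>" using lo[of "x t"] \<Gamma> by simp
          then show ?thesis using \<eta> by (simp add: class_K_inf_le_iff[OF K(1)])
        qed
        then show ?thesis using \<delta>(1) by blast
      qed
      have attractive: "x \<longlonglongrightarrow> 0"
        if "x0 \<in> X" "closed_loop f U Z l \<kappa> N M x0 x u" for x0 x u
      proof (rule class_K_inf_tendsto_zeroD[OF K(1)])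
        have "(\<lambda>t. lmin (x t)) \<longlonglongrightarrow> 0"
          using that by (intro lmin_tendsto_zero[of x0 x u]) (auto simp: X_def)
        then show "(\<lambda>t. \<alpha>_lo (norm (x t))) \<longlonglongrightarrow> 0"
          by (rule Lim_null_comparison[rotated]) (simp add: lo class_K_inf_nonneg[OF K(1)])
      qed
      \<comment> \<open>Passing from the value to \<open>lmin x0\<close> costs a factor
        \<open>\<Gamma>\<close>, which explains the witness \<open>q / \<Gamma>\<close> for
        \<open>\<alpha>\<close>.\<close>
      have optimal: "ennreal (1 / q) * V N M x0
          \<le> ennreal (1 / (q / \<Gamma>)) * inf_horizon_value f U Z l x0" if "x0 \<in> X" for x0
      proof -
        have "ennreal (1 / q) * V N M x0 \<le> ennreal (1 / q) * ennreal (\<Gamma> * lmin x0)"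
          using V_le[OF that] by (intro mult_left_mono) auto
        also have "\<dots> = ennreal (1 / (q / \<Gamma>)) * ennreal (lmin x0)"
          using q_bounds \<Gamma> by (simp add: ennreal_mult[symmetric] lmin_nonneg)
        also have "\<dots> \<le> ennreal (1 / (q / \<Gamma>)) * inf_horizon_value f U Z l x0"
          by (intro mult_left_mono lmin_le_inf_horizon_value) simp
        finally show ?thesis .
      qed
      have "0 < q / \<Gamma>" "q / \<Gamma> \<le> 1" using q_bounds \<Gamma> by simp_all
      then have "\<exists>\<alpha> \<epsilon>. 0 < \<alpha> \<and> \<alpha> \<le> 1 \<and> 0 < \<epsilon> \<and> \<epsilon> \<le> 1 \<and>
            (\<forall>x0\<in>X. \<forall>x u. closed_loop f U Z l \<kappa> N M x0 x u \<longrightarrow>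
               (\<Sum>k. ennreal (l (x k) (u k))) \<le> ennreal (1 / \<epsilon>) * V N M x0 \<and>
               ennreal (1 / \<epsilon>) * V N M x0 \<le> ennreal (1 / \<alpha>) * inf_horizon_value f U Z l x0)"
        using q_bounds closed_loop_cost optimal
        by (intro exI[of _ "q / \<Gamma>"] exI[of _ q]) (simp add: X_def)
      moreover have "origin_asymp_stable X (\<lambda>x0 x. \<exists>u. closed_loop f U Z l \<kappa> N M x0 x u)"
        unfolding origin_asymp_stable_def using stable attractive by blast
      moreover have "\<forall>x0\<in>X. \<forall>x u. closed_loop f U Z l \<kappa> N M x0 x u \<longrightarrow>
            (\<forall>t. mpc_feasible f U Z l \<kappa> N M (x t)) \<and> (\<forall>t. (x t, u t) \<in> Z)"
        using feasible_at constraints_at(2) by (simp add: X_def)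
      ultimately show "let X = {x. V N M x \<le> ennreal v} in
         (\<forall>x0\<in>X. \<forall>x u. closed_loop f U Z l \<kappa> N M x0 x u \<longrightarrow>
            (\<forall>t. mpc_feasible f U Z l \<kappa> N M (x t)) \<and> (\<forall>t. (x t, u t) \<in> Z)) \<and>
         origin_asymp_stable X (\<lambda>x0 x. \<exists>u. closed_loop f U Z l \<kappa> N M x0 x u) \<and>
         (\<exists>\<alpha> \<epsilon>. 0 < \<alpha> \<and> \<alpha> \<le> 1 \<and> 0 < \<epsilon> \<and> \<epsilon> \<le> 1 \<and>
            (\<forall>x0\<in>X. \<forall>x u. closed_loop f U Z l \<kappa> N M x0 x u \<longrightarrow>
               (\<Sum>k. ennreal (l (x k) (u k))) \<le> ennreal (1 / \<epsilon>) * V N M x0 \<and>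
               ennreal (1 / \<epsilon>) * V N M x0 \<le> ennreal (1 / \<alpha>) * inf_horizon_value f U Z l x0))"
        by (simp add: Let_def X_def[symmetric])
    qed
  qed
qed

end
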